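(* Let $(X,\mathcal{B}_X,\mu,T)$ be a $\mathbb{Z}^2$-measure preserving dynamical system and let $\vec{v}=(1,\beta)$ with $\beta\in\mathbb{R}$ irrational. For any $b\in(0,\infty)$, the following conditions are equivalent. (a) $(X,\mathcal{B}_X,\mu,T)$ is $\vec{v}$-weakly mixing. (b) For every nontrivial finite measurable partition $\alpha$ of $X$, there exists an infinite sequence $S=\{(m_i,n_i)\}_{i=1}^{\infty}$ of pairwise distinct elements of $\Lambda^{\vec{v}}(b)$ such that $h^{S}_{\mu}(T,\alpha)>0$.
   Context: A $\mathbb{Z}^2$-measure preserving dynamical system $(X,\mathcal{B}_X,\mu,T)$ consists of a compact metric space $X$, its Borel $\sigma$-algebra $\mathcal{B}_X$, a group homomorphism $(m,n)\mapsto T^{(m,n)}$ from the additive group $\mathbb{Z}^2$ to the group of homeomorphisms of $X$, and a Borel probability measure $\mu$ invariant under every $T^{(m,n)}$. For $f\in L^2(X,\mathcal{B}_X,\mu)$, $U_T^{(m,n)}f=f\circ T^{(m,n)}$; $1_B$ is the indicator function of $B$. For $\vec{v}=(1,\beta)$ and $b\in(0,\infty)$, $\Lambda^{\vec{v}}(b)=\{(m,n)\in\mathbb{Z}^2:\beta m-b\le n\le\beta m+b\}$. The directional Kronecker algebra $\mathcal{K}_\mu^{\vec{v}}$ is the $\sigma$-algebra of all $B\in\mathcal{B}_X$ such that the closure of $\{U_T^{(m,n)}1_B:(m,n)\in\Lambda^{\vec{v}}(b)\}$ is compact in $L^2(X,\mathcal{B}_X,\mu)$; it does not depend on the choice of $b\in(0,\infty)$.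 The system is called $\vec{v}$-weakly mixing if $\mathcal{K}_\mu^{\vec{v}}$ is trivial, i.e. $\mathcal{K}_\mu^{\vec{v}}=\{X,\emptyset\}$ modulo $\mu$-null sets (every $B\in\mathcal{K}_\mu^{\vec{v}}$ has $\mu(B)\in\{0,1\}$). For a finite measurable partition $\alpha$, $H_\mu(\alpha)=-\sum_{A\in\alpha}\mu(A)\log\mu(A)$ (with $0\log 0=0$), $T^{-(m,n)}\alpha=\{T^{-(m,n)}A:A\in\alpha\}$, $\bigvee$ denotes the common refinement of partitions, and for an infinite sequence $S=\{(m_i,n_i)\}_{i=1}^\infty$ in $\Lambda^{\vec{v}}(b)$, $$h^S_\mu(T,\alpha)=\limsup_{k\to\infty}\frac1k H_\mu\Big(\bigvee_{i=1}^k T^{-(m_i,n_i)}\alpha\Big).$$ A finite measurable partition is nontrivial if it contains some $A$ with $0<\mu(A)<1$. *)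

theory Defs
  imports "HOL-Probability.Probability"
begin

section \<open>The metric space of square integrable functions modulo null sets\<close>

definition L2_functions :: "'a measure \<Rightarrow> ('a \<Rightarrow> real) set" where
  "L2_functions M = {f \<in> borel_measurable M. integrable M (\<lambda>x. (f x)\<^sup>2)}"

definition L2_rel :: "'a measure \<Rightarrow> (('a \<Rightarrow> real) \<times> ('a \<Rightarrow> real)) set" where
  "L2_rel M = {(f, g). f \<in> L2_functions M \<and> g \<in> L2_functions M \<and> (AE x in M. f x = g x)}"

definition L2_class :: "'a measure \<Rightarrow> ('a \<Rightarrow> real) \<Rightarrow> ('a \<Rightarrow> real) set" where
  "L2_class M f = L2_rel M `` {f}"

definition L2_space :: "'a measure \<Rightarrow> ('a \<Rightarrow> real) set set" where
  "L2_space M = L2_functions M // L2_rel M"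

text \<open>The distance is computed on chosen representatives; by \<open>L2_dist_class\<close> below the choice
  does not matter.\<close>

definition L2_dist :: "'a measure \<Rightarrow> ('a \<Rightarrow> real) set \<Rightarrow> ('a \<Rightarrow> real) set \<Rightarrow> real" where
  "L2_dist M F G = sqrt (\<integral>x. ((SOME f. f \<in> F) x - (SOME g. g \<in> G) x)\<^sup>2 \<partial>M)"

definition L2_metric :: "'a measure \<Rightarrow> ('a \<Rightarrow> real) set metric" where
  "L2_metric M = metric (L2_space M, L2_dist M)"

lemma L2_lin_bound:
  fixes a b t :: real
  assumes "t > 0"
  shows "(a + b)\<^sup>2 \<le> (1 + t) * a\<^sup>2 + (1 + 1/t) * b\<^sup>2"
proof -
  have "0 \<le> (t * a - b)\<^sup>2 / t"
    using assms by simp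
  also have "\<dots> = t * a\<^sup>2 - 2 * a * b + b\<^sup>2 / t"
    using assms by (simp add: power2_eq_square field_simps)
  finally show ?thesis
    by (simp add: power2_eq_square algebra_simps)
qed

lemma L2_functions_add:
  assumes "f \<in> L2_functions M" "g \<in> L2_functions M"
  shows "(\<lambda>x. f x + g x) \<in> L2_functions M"
proof -
  have [measurable]: "f \<in> borel_measurable M" "g \<in> borel_measurable M"
    using assms by (auto simp: L2_functions_def)
  have "integrable M (\<lambda>x. (f x + g x)\<^sup>2)"
  proof (rule Bochner_Integration.integrable_bound)
    show "integrable M (\<lambda>x. 2 * (f x)\<^sup>2 + 2 * (g x)\<^sup>2)"
      using assms by (auto simp: L2_functions_def)
    show "AE x in M. norm ((f x + g x)\<^sup>2) \<le> norm (2 * (f x)\<^sup>2 + 2 * (g x)\<^sup>2)"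
      using L2_lin_bound[of 1] by (auto simp: abs_of_nonneg)
  qed simp
  then show ?thesis by (simp add: L2_functions_def)
qed

lemma L2_functions_diff:
  assumes "f \<in> L2_functions M" "g \<in> L2_functions M"
  shows "(\<lambda>x. f x - g x) \<in> L2_functions M"
proof -
  have "(\<lambda>x. - g x) \<in> L2_functions M"
    using assms by (auto simp: L2_functions_def)
  from L2_functions_add[OF assms(1) this] show ?thesis by simp
qed

lemma L2_Minkowski:
  assumes f: "f \<in> L2_functions M" and g: "g \<in> L2_functions M"
  shows "sqrt (\<integral>x. (f x + g x)\<^sup>2 \<partial>M) \<le> sqrt (\<integral>x. (f x)\<^sup>2 \<partial>M) + sqrt (\<integral>x. (g x)\<^sup>2 \<partial>M)"
proof -
  define a where "a = sqrt (\<integral>x. (f x)\<^sup>2 \<partial>M)"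
  define b where "b = sqrt (\<integral>x. (g x)\<^sup>2 \<partial>M)"
  have ab: "a \<ge> 0" "b \<ge> 0" and a2: "(\<integral>x. (f x)\<^sup>2 \<partial>M) = a\<^sup>2" and b2: "(\<integral>x. (g x)\<^sup>2 \<partial>M) = b\<^sup>2"
    by (auto simp: a_def b_def)
  have if': "integrable M (\<lambda>x. (f x)\<^sup>2)" and ig: "integrable M (\<lambda>x. (g x)\<^sup>2)"
    using f g by (auto simp: L2_functions_def)
  have is': "integrable M (\<lambda>x. (f x + g x)\<^sup>2)"
    using L2_functions_add[OF f g] by (auto simp: L2_functions_def)
  have bound: "(\<integral>x. (f x + g x)\<^sup>2 \<partial>M) \<le> (1 + t) * a\<^sup>2 + (1 + 1/t) * b\<^sup>2" if "t > 0" for t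
  proof -
    have "(\<integral>x. (f x + g x)\<^sup>2 \<partial>M) \<le> (\<integral>x. (1 + t) * (f x)\<^sup>2 + (1 + 1/t) * (g x)\<^sup>2 \<partial>M)"
      using if' ig is' L2_lin_bound[OF that] by (intro integral_mono) auto
    also have "\<dots> = (1 + t) * a\<^sup>2 + (1 + 1/t) * b\<^sup>2"
      using if' ig by (simp add: a2 b2)
    finally show ?thesis .
  qed
  have "(\<integral>x. (f x + g x)\<^sup>2 \<partial>M) \<le> (a + b + e)\<^sup>2" if "e > 0" for e
  proof -
    define a' b' where "a' = a + e/2" and "b' = b + e/2"
    have pos: "a' > 0" "b' > 0" using ab that by (auto simp: a'_def b'_def)
    have "(\<integral>x. (f x + g x)\<^sup>2 \<partial>M) \<le> (1 + b'/a') * a\<^sup>2 + (1 + 1/(b'/a')) * b\<^sup>2"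
      using pos by (intro bound) auto
    also have "\<dots> \<le> (1 + b'/a') * a'\<^sup>2 + (1 + 1/(b'/a')) * b'\<^sup>2"
      using pos ab that
      by (intro add_mono mult_left_mono power_mono) (auto simp: a'_def b'_def)
    also have "\<dots> = (a' + b')\<^sup>2"
      using pos by (simp add: power2_eq_square field_simps)
    also have "a' + b' = a + b + e" by (simp add: a'_def b'_def)
    finally show ?thesis .
  qed
  then have "sqrt (\<integral>x. (f x + g x)\<^sup>2 \<partial>M) \<le> a + b + e" if "e > 0" for e
    using that ab by (intro real_le_lsqrt) auto
  then have "sqrt (\<integral>x. (f x + g x)\<^sup>2 \<partial>M) \<le> a + b"
    by (rule field_le_epsilon)
  then show ?thesis by (simp add: a_def b_def)
qed

lemma equiv_L2_rel: "equiv (L2_functions M) (L2_rel M)"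
proof (rule equivI)
  show "refl_on (L2_functions M) (L2_rel M)"
    by (auto simp: refl_on_def L2_rel_def)
  show "sym (L2_rel M)"
    by (auto simp: sym_def L2_rel_def eq_commute)
  show "trans (L2_rel M)"
    by (auto simp: trans_def L2_rel_def intro: AE_mp)
qed (auto simp: L2_rel_def)

lemma L2_class_in_space: "f \<in> L2_functions M \<Longrightarrow> L2_class M f \<in> L2_space M"
  by (auto simp: L2_class_def L2_space_def quotientI)

lemma L2_spaceE:
  assumes "F \<in> L2_space M"
  obtains f where "f \<in> L2_functions M" "F = L2_class M f"
  using assms by (auto simp: L2_class_def L2_space_def quotient_def)

lemma L2_class_eq_iff:
  assumes "f \<in> L2_functions M" "g \<in> L2_functions M"
  shows "L2_class M f = L2_class M g \<longleftrightarrow> (AE x in M. f x = g x)"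
  unfolding L2_class_def
  using eq_equiv_class_iff[OF equiv_L2_rel assms] assms by (auto simp: L2_rel_def)

lemma L2_class_some:
  assumes "f \<in> L2_functions M"
  shows "(SOME g. g \<in> L2_class M f) \<in> L2_functions M"
    and "AE x in M. (SOME g. g \<in> L2_class M f) x = f x"
proof -
  have "f \<in> L2_class M f"
    using assms by (simp add: L2_class_def L2_rel_def)
  then have "(SOME g. g \<in> L2_class M f) \<in> L2_class M f"
    by (rule someI[where P = "\<lambda>g. g \<in> L2_class M f"])
  then show "(SOME g. g \<in> L2_class M f) \<in> L2_functions M"
    and "AE x in M. (SOME g. g \<in> L2_class M f) x = f x"
    by (auto simp: L2_class_def L2_rel_def eq_commute)
qed

lemma L2_dist_class:
  assumes "f \<in> L2_functions M" "g \<in> L2_functions M"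
  shows "L2_dist M (L2_class M f) (L2_class M g) = sqrt (\<integral>x. (f x - g x)\<^sup>2 \<partial>M)"
proof -
  note s = L2_class_some[OF assms(1)] L2_class_some[OF assms(2)]
  have "(\<integral>x. ((SOME h. h \<in> L2_class M f) x - (SOME h. h \<in> L2_class M g) x)\<^sup>2 \<partial>M)
      = (\<integral>x. (f x - g x)\<^sup>2 \<partial>M)"
  proof (rule integral_cong_AE)
    show "AE x in M. ((SOME h. h \<in> L2_class M f) x - (SOME h. h \<in> L2_class M g) x)\<^sup>2 = (f x - g x)\<^sup>2"
      using s(2,4) by eventually_elim simp
  qed (use s assms in \<open>auto simp: L2_functions_def\<close>)
  then show ?thesis by (simp add: L2_dist_def)
qed

lemma Metric_space_L2: "Metric_space (L2_space M) (L2_dist M)"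
proof
  show "0 \<le> L2_dist M F G" for F G
    by (simp add: L2_dist_def)
  show "L2_dist M F G = L2_dist M G F" for F G
    by (simp add: L2_dist_def power2_commute)
  show "L2_dist M F G = 0 \<longleftrightarrow> F = G" if "F \<in> L2_space M" "G \<in> L2_space M" for F G
  proof -
    from that obtain f g where f: "f \<in> L2_functions M" "F = L2_class M f"
      and g: "g \<in> L2_functions M" "G = L2_class M g"
      by (metis L2_spaceE)
    have "integrable M (\<lambda>x. (f x - g x)\<^sup>2)"
      using L2_functions_diff[OF f(1) g(1)] by (simp add: L2_functions_def)
    then have "(\<integral>x. (f x - g x)\<^sup>2 \<partial>M) = 0 \<longleftrightarrow> (AE x in M. (f x - g x)\<^sup>2 = 0)"
      by (intro integral_nonneg_eq_0_iff_AE) auto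
    then show ?thesis
      using f g by (simp add: L2_dist_class L2_class_eq_iff)
  qed
  show "L2_dist M F H \<le> L2_dist M F G + L2_dist M G H"
    if "F \<in> L2_space M" "G \<in> L2_space M" "H \<in> L2_space M" for F G H
  proof -
    from that obtain f g h where f: "f \<in> L2_functions M" "F = L2_class M f"
      and g: "g \<in> L2_functions M" "G = L2_class M g" and h: "h \<in> L2_functions M" "H = L2_class M h"
      by (metis L2_spaceE)
    show ?thesis
      using L2_Minkowski[OF L2_functions_diff[OF f(1) g(1)] L2_functions_diff[OF g(1) h(1)]] f g h
      by (simp add: L2_dist_class)
  qed
qed

lemma mspace_L2_metric [simp]: "mspace (L2_metric M) = L2_space M"
  and mdist_L2_metric [simp]: "mdist (L2_metric M) = L2_dist M"
  using Metric_space.mspace_metric[OF Metric_space_L2] Metric_space.mdist_metric[OF Metric_space_L2]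
  by (auto simp: L2_metric_def)


section \<open>Actions of the integer lattice\<close>

text \<open>The additivity axiom together with bijectivity of each \<open>T v\<close> makes \<open>T\<close> a homomorphism
  from the additive group of integer pairs to the homeomorphism group.\<close>

locale Z2_mpds = prob_space M
  for M :: "'a :: metric_space measure" +
  fixes T :: "int \<times> int \<Rightarrow> 'a \<Rightarrow> 'a"
  assumes compact_UNIV: "compact (UNIV :: 'a set)"
    and sets_M: "sets M = sets borel"
    and T_homeo: "\<And>v. \<exists>g. homeomorphism UNIV UNIV (T v) g"
    and T_add: "\<And>u v. T (u + v) = T u \<circ> T v"
    and T_invariant: "\<And>v. distr M M (T v) = M"

definition koopman :: "(int \<times> int \<Rightarrow> 'a \<Rightarrow> 'a) \<Rightarrow> int \<times> int \<Rightarrow> ('a \<Rightarrow> real) \<Rightarrow> 'a \<Rightarrow> real" where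
  "koopman T v f = f \<circ> T v"

text \<open>The strip of half-width \<open>b\<close> around the line in direction \<open>(1, \<beta>)\<close>.\<close>

definition strip :: "real \<Rightarrow> real \<Rightarrow> (int \<times> int) set" where
  "strip \<beta> b = {(m, n). \<beta> * of_int m - b \<le> of_int n \<and> of_int n \<le> \<beta> * of_int m + b}"

definition strip_orbit ::
  "'a measure \<Rightarrow> (int \<times> int \<Rightarrow> 'a \<Rightarrow> 'a) \<Rightarrow> real \<Rightarrow> real \<Rightarrow> 'a set \<Rightarrow> ('a \<Rightarrow> real) set set" where
  "strip_orbit M T \<beta> b B = (\<lambda>v. L2_class M (koopman T v (indicator B))) ` strip \<beta> b"

text \<open>The defining condition does not depend on the width \<open>b\<close>; see
  \<open>directional_Kronecker_width\<close> below.\<close>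

definition directional_Kronecker ::
  "'a measure \<Rightarrow> (int \<times> int \<Rightarrow> 'a \<Rightarrow> 'a) \<Rightarrow> real \<Rightarrow> 'a set set" where
  "directional_Kronecker M T \<beta> = {B \<in> sets M. \<forall>b>0.
     compactin (mtopology_of (L2_metric M))
       (mtopology_of (L2_metric M) closure_of strip_orbit M T \<beta> b B)}"

definition directional_weak_mixing ::
  "'a measure \<Rightarrow> (int \<times> int \<Rightarrow> 'a \<Rightarrow> 'a) \<Rightarrow> real \<Rightarrow> bool" where
  "directional_weak_mixing M T \<beta> \<longleftrightarrow>
     (\<forall>B \<in> directional_Kronecker M T \<beta>. measure M B = 0 \<or> measure M B = 1)"


section \<open>Sequence entropy\<close>

definition finite_measurable_partition :: "'a measure \<Rightarrow> 'a set set \<Rightarrow> bool" where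
  "finite_measurable_partition M \<alpha> \<longleftrightarrow> finite \<alpha> \<and> \<alpha> \<subseteq> sets M \<and> partition_on (space M) \<alpha>"

definition nontrivial_partition :: "'a measure \<Rightarrow> 'a set set \<Rightarrow> bool" where
  "nontrivial_partition M \<alpha> \<longleftrightarrow> (\<exists>A\<in>\<alpha>. 0 < measure M A \<and> measure M A < 1)"

definition partition_entropy :: "'a measure \<Rightarrow> 'a set set \<Rightarrow> real" where
  "partition_entropy M \<alpha> = - (\<Sum>A\<in>\<alpha>. measure M A * ln (measure M A))"

definition translate_partition ::
  "(int \<times> int \<Rightarrow> 'a \<Rightarrow> 'a) \<Rightarrow> int \<times> int \<Rightarrow> 'a set set \<Rightarrow> 'a set set" where
  "translate_partition T v \<alpha> = (\<lambda>A. T (- v) ` A) ` \<alpha>"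

text \<open>Sequences are indexed from \<open>0\<close>.\<close>

definition sequence_entropy ::
  "'a measure \<Rightarrow> (int \<times> int \<Rightarrow> 'a \<Rightarrow> 'a) \<Rightarrow> (nat \<Rightarrow> int \<times> int) \<Rightarrow> 'a set set \<Rightarrow> ereal" where
  "sequence_entropy M T S \<alpha> = limsup (\<lambda>k. ereal (1 / real k *
     partition_entropy M (common_refinement ((\<lambda>i. translate_partition T (S i) \<alpha>) ` {..<k}))))"


section \<open>Independence of the width\<close>

context Z2_mpds
begin

lemma T_measurable [measurable]: "T v \<in> measurable M M"
proof -
  obtain g where "homeomorphism UNIV UNIV (T v) g" using T_homeo by blast
  then have "T v \<in> borel_measurable borel"
    by (intro borel_measurable_continuous_onI) (auto simp: homeomorphism_def)
  then show ?thesis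
    by (simp add: measurable_cong_sets[OF sets_M sets_M])
qed

lemma AE_T:
  assumes "AE x in M. P x"
  shows "AE x in M. P (T v x)"
proof -
  from AE_E[OF assms] obtain N where N: "{x \<in> space M. \<not> P x} \<subseteq> N" "N \<in> sets M" "emeasure M N = 0"
    by metis
  have "emeasure M (T v -` N \<inter> space M) = emeasure (distr M M (T v)) N"
    using N by (simp add: emeasure_distr)
  also have "\<dots> = 0" using N by (simp add: T_invariant)
  finally have e: "emeasure M (T v -` N \<inter> space M) = 0" .
  have "T v -` N \<inter> space M \<in> null_sets M"
    using e N by (auto simp: null_sets_def)
  moreover have "{x \<in> space M. \<not> P (T v x)} \<subseteq> T v -` N \<inter> space M"
    using N(1) measurable_space[OF T_measurable, of _ v] by blast
  ultimately show ?thesis by (rule AE_I')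
qed

lemma koopman_L2:
  assumes "f \<in> L2_functions M"
  shows "koopman T v f \<in> L2_functions M"
    and "(\<integral>x. (koopman T v f x)\<^sup>2 \<partial>M) = (\<integral>x. (f x)\<^sup>2 \<partial>M)"
proof -
  have [measurable]: "f \<in> borel_measurable M" and i: "integrable M (\<lambda>x. (f x)\<^sup>2)"
    using assms by (auto simp: L2_functions_def)
  have "integrable (distr M M (T v)) (\<lambda>x. (f x)\<^sup>2)"
    using i by (simp add: T_invariant)
  then have "integrable M (\<lambda>x. (f (T v x))\<^sup>2)"
    by (subst (asm) integrable_distr_eq) auto
  then show "koopman T v f \<in> L2_functions M"
    by (auto simp: L2_functions_def koopman_def comp_def)
  have "(\<integral>x. (f x)\<^sup>2 \<partial>distr M M (T v)) = (\<integral>x. (f (T v x))\<^sup>2 \<partial>M)"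
    by (rule integral_distr) auto
  then show "(\<integral>x. (koopman T v f x)\<^sup>2 \<partial>M) = (\<integral>x. (f x)\<^sup>2 \<partial>M)"
    by (simp add: T_invariant koopman_def)
qed

definition L2_koopman :: "int \<times> int \<Rightarrow> ('a \<Rightarrow> real) set \<Rightarrow> ('a \<Rightarrow> real) set" where
  "L2_koopman v F = L2_class M (koopman T v (SOME f. f \<in> F))"

lemma L2_koopman_class:
  assumes "f \<in> L2_functions M"
  shows "L2_koopman v (L2_class M f) = L2_class M (koopman T v f)"
  unfolding L2_koopman_def
  using AE_T[OF L2_class_some(2)[OF assms], of v] L2_class_some(1)[OF assms] assms
  by (subst L2_class_eq_iff) (auto simp: koopman_L2, simp add: koopman_def)

lemma continuous_map_L2_koopman:
  "continuous_map (mtopology_of (L2_metric M)) (mtopology_of (L2_metric M)) (L2_koopman v)"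
proof (rule Lipschitz_continuous_imp_continuous_map)
  have "L2_koopman v F \<in> L2_space M \<and> L2_dist M (L2_koopman v F) (L2_koopman v G) = L2_dist M F G"
    if "F \<in> L2_space M" "G \<in> L2_space M" for F G
  proof -
    from that obtain f g where f: "f \<in> L2_functions M" "F = L2_class M f"
      and g: "g \<in> L2_functions M" "G = L2_class M g"
      by (metis L2_spaceE)
    show ?thesis
      using koopman_L2(2)[OF L2_functions_diff[OF f(1) g(1)], of v] f g
      by (simp add: L2_koopman_class L2_dist_class L2_class_in_space koopman_L2(1))
         (simp add: koopman_def)
  qed
  then show "Lipschitz_continuous_map (L2_metric M) (L2_metric M) (L2_koopman v)"
    unfolding Lipschitz_continuous_map_def by (auto intro!: exI[of _ 1])
qed

lemma indicator_L2: "B \<in> sets M \<Longrightarrow> indicator B \<in> L2_functions M"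
  by (auto simp: L2_functions_def intro!: integrable_const_bound[where B = 1] split: split_indicator)

lemma strip_finite_cover:
  assumes "b > 0"
  shows "\<exists>F. finite F \<and> (\<forall>v \<in> strip \<beta> b'. \<exists>w\<in>F. v - w \<in> strip \<beta> b)"
proof -
  define c where "c = (\<lambda>v :: int \<times> int. \<lfloor>(real_of_int (snd v) - \<beta> * real_of_int (fst v)) / b\<rfloor>)"
  define r where "r = (\<lambda>k. SOME v. v \<in> strip \<beta> b' \<and> c v = k)"
  have "c ` strip \<beta> b' \<subseteq> {\<lfloor>- b' / b\<rfloor> .. \<lfloor>b' / b\<rfloor>}"
  proof (clarsimp simp: c_def strip_def, intro conjI floor_mono)
    fix m n :: int
    assume "\<beta> * m - b' \<le> n" "n \<le> \<beta> * m + b'"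
    then show "- (b' / b) \<le> (n - \<beta> * m) / b" "(n - \<beta> * m) / b \<le> b' / b"
      using assms divide_right_mono[of "- b'" "n - \<beta> * m" b] by (auto intro: divide_right_mono)
  qed
  then have "finite (r ` c ` strip \<beta> b')"
    using finite_subset by blast
  moreover have "v - r (c v) \<in> strip \<beta> b" if "v \<in> strip \<beta> b'" for v
  proof -
    define w where "w = r (c v)"
    have "c w = c v"
      unfolding w_def r_def using someI[of "\<lambda>u. u \<in> strip \<beta> b' \<and> c u = c v" v] that by blast
    then have "\<bar>(snd v - \<beta> * fst v) / b - (snd w - \<beta> * fst w) / b\<bar> \<le> 1"
      unfolding c_def by linarith
    then have "\<bar>(snd v - \<beta> * fst v) - (snd w - \<beta> * fst w)\<bar> \<le> b"
      using assms by (simp add: diff_divide_distrib[symmetric])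
    then have "v - w \<in> strip \<beta> b"
      by (auto simp: strip_def algebra_simps split: prod.splits abs_split)
    then show ?thesis by (simp add: w_def)
  qed
  ultimately show ?thesis by blast
qed

lemma strip_orbit_compact_mono:
  assumes B: "B \<in> sets M" and "b > 0"
    and comp: "compactin (mtopology_of (L2_metric M))
      (mtopology_of (L2_metric M) closure_of strip_orbit M T \<beta> b B)"
  shows "compactin (mtopology_of (L2_metric M))
      (mtopology_of (L2_metric M) closure_of strip_orbit M T \<beta> b' B)"
proof -
  let ?X = "mtopology_of (L2_metric M)"
  let ?C = "?X closure_of strip_orbit M T \<beta> b B"
  obtain F where F: "finite F" "\<And>v. v \<in> strip \<beta> b' \<Longrightarrow> \<exists>w\<in>F. v - w \<in> strip \<beta> b"
    using strip_finite_cover[OF \<open>b > 0\<close>] by metis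
  define D where "D = (\<Union>w\<in>F. L2_koopman w ` ?C)"
  have D: "compactin ?X D"
    unfolding D_def using F(1) image_compactin[OF comp continuous_map_L2_koopman]
    by (intro compactin_Union) auto
  have "Hausdorff_space ?X"
    by (simp add: L2_metric_def Metric_space.mtopology_of[OF Metric_space_L2]
        Metric_space.Hausdorff_space_mtopology[OF Metric_space_L2])
  then have cl: "closedin ?X D"
    using D by (rule compactin_imp_closedin)
  have sub: "strip_orbit M T \<beta> b B \<subseteq> ?C"
    by (rule closure_of_subset)
       (auto simp: strip_orbit_def intro!: L2_class_in_space koopman_L2 indicator_L2 B)
  have "strip_orbit M T \<beta> b' B \<subseteq> D"
  proof
    fix G assume "G \<in> strip_orbit M T \<beta> b' B"
    then obtain v where v: "v \<in> strip \<beta> b'" "G = L2_class M (koopman T v (indicator B))"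
      by (auto simp: strip_orbit_def)
    obtain w where w: "w \<in> F" "v - w \<in> strip \<beta> b" using F v by blast
    have "koopman T w (koopman T (v - w) (indicator B)) = koopman T v (indicator B)"
      using T_add[of "v - w" w] by (simp add: koopman_def comp_assoc)
    then have "G = L2_koopman w (L2_class M (koopman T (v - w) (indicator B)))"
      using v B by (simp add: L2_koopman_class koopman_L2 indicator_L2)
    moreover have "L2_class M (koopman T (v - w) (indicator B)) \<in> ?C"
      using w sub by (auto simp: strip_orbit_def)
    ultimately show "G \<in> D" using w by (auto simp: D_def)
  qed
  then have "?X closure_of strip_orbit M T \<beta> b' B \<subseteq> D"
    using cl by (rule closure_of_minimal)
  then show ?thesis
    using D closed_compactin closedin_closure_of by blast
qed

lemma directional_Kronecker_width:
  assumes "b > 0"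
  shows "directional_Kronecker M T \<beta> = {B \<in> sets M.
     compactin (mtopology_of (L2_metric M))
       (mtopology_of (L2_metric M) closure_of strip_orbit M T \<beta> b B)}"
  unfolding directional_Kronecker_def using assms strip_orbit_compact_mono by blast

end

end

theory Submission
  imports Defs
begin

text \<open>A set outside the directional Kronecker algebra is one whose translates along the strip are
  not totally bounded in the measure algebra. If conditioning on a finite partition \<open>P\<close> left little
  entropy in every translate \<open>B\<^sub>v\<close>, then every \<open>B\<^sub>v\<close> would be close to a union of atoms of \<open>P\<close>, and the
  finitely many such unions would give a finite net. So there is always a new translate that
  adds a fixed amount of entropy, and choosing translates greedily yields positive sequence entropy.
  Conversely, along a totally bounded orbit each translate differs from one of finitely many fixed
  sets by a set of small measure, and subadditivity bounds the entropy per step by the small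
  entropy of these differences.\<close>

section \<open>Entropy of simple functions\<close>

text \<open>This is \<open>ln t \<le> t - 1\<close> at \<open>t = p / s\<close>, multiplied by
  \<open>-p\<close>. It replaces a logarithmic entropy term by a rational one.\<close>

lemma neg_mult_ln_divide_ge:
  fixes p s :: real
  assumes "0 \<le> p" "p \<le> s"
  shows "p * (s - p) / s \<le> - (p * ln (p / s))"
proof (cases "p = 0")
  case False
  then have "p > 0" "s > 0" using assms by auto
  then have "ln (p / s) \<le> p / s - 1"
    by (intro ln_le_minus_one) auto
  then have "p * ln (p / s) \<le> p * (p / s - 1)"
    using \<open>p > 0\<close> by simp
  then show ?thesis
    using \<open>s > 0\<close> by (simp add: field_simps)
qed simp

text \<open>The right-hand side is \<open>p + q\<close> times the entropy of the normalised pair,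
  hence at least \<open>2 * p * q / (p + q)\<close>. This dominates the minimum because the maximum
  is at least half of \<open>p + q\<close>.\<close>

lemma min_le_binary_entropy:
  fixes p q :: real
  assumes "0 \<le> p" "0 \<le> q"
  shows "min p q \<le> - (p * ln (p / (p + q))) - q * ln (q / (p + q))"
proof (cases "p + q = 0")
  case True
  then show ?thesis using assms by auto
next
  case False
  then have s: "p + q > 0" using assms by auto
  have "min p q * (p + q) \<le> 2 * (p * q)"
    using assms mult_left_mono[of "p + q" "2 * max p q" "min p q"]
    by (auto simp: min_def max_def algebra_simps split: if_splits)
  then have "min p q \<le> 2 * (p * q) / (p + q)"
    using s by (simp only: pos_le_divide_eq)
  also have "\<dots> = p * q / (p + q) + q * p / (p + q)"
    by (simp add: algebra_simps add_divide_distrib[symmetric])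
  also have "\<dots> \<le> - (p * ln (p / (p + q))) - q * ln (q / (p + q))"
  proof -
    have "p * q / (p + q) \<le> - (p * ln (p / (p + q)))"
      using neg_mult_ln_divide_ge[of p "p + q"] assms by simp
    moreover have "q * p / (p + q) \<le> - (q * ln (q / (p + q)))"
      using neg_mult_ln_divide_ge[of q "p + q"] assms by simp
    ultimately show ?thesis by linarith
  qed
  finally show ?thesis .
qed

text \<open>Writing \<open>- ln p\<close> as \<open>2 * ln (1 / sqrt p)\<close> before using
  \<open>ln t \<le> t - 1\<close> bounds the first term by \<open>2 * sqrt p - 2 * p\<close>. The
  second term is at most \<open>p\<close>, which the surplus absorbs.\<close>

lemma binary_entropy_le_sqrt:
  fixes p :: real
  assumes "0 \<le> p" "p \<le> 1"
  shows "- (p * ln p) - (1 - p) * ln (1 - p) \<le> 2 * sqrt p"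
proof -
  have "- (p * ln p) \<le> 2 * sqrt p - 2 * p"
  proof (cases "p = 0")
    case False
    then have p: "p > 0" using assms by auto
    have "- ln p = 2 * ln (1 / sqrt p)"
      using p by (simp add: ln_div ln_sqrt)
    also have "\<dots> \<le> 2 * (1 / sqrt p - 1)"
      using p by (intro mult_left_mono ln_le_minus_one) auto
    finally have "p * (- ln p) \<le> p * (2 * (1 / sqrt p - 1))"
      using p by (intro mult_left_mono) auto
    also have "\<dots> = 2 * sqrt p - 2 * p"
      using p by (simp add: right_diff_distrib real_div_sqrt flip: times_divide_eq_left)
    finally show ?thesis by simp
  qed simp
  moreover have "- ((1 - p) * ln (1 - p)) \<le> p"
  proof (cases "p = 1")
    case False
    then have p: "1 - p > 0" using assms by auto
    have "- ln (1 - p) = ln (1 / (1 - p))"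
      using p by (simp add: ln_div)
    also have "\<dots> \<le> 1 / (1 - p) - 1"
      using p by (intro ln_le_minus_one) auto
    finally have "(1 - p) * (- ln (1 - p)) \<le> (1 - p) * (1 / (1 - p) - 1)"
      using p by (intro mult_left_mono) auto
    also have "\<dots> = p"
      using p by (simp add: field_simps)
    finally show ?thesis by simp
  qed simp
  ultimately show ?thesis using assms by simp
qed

section \<open>Shannon entropy of lists of simple functions and of events\<close>

context information_space
begin

lemma entropy_nonneg_simple:
  assumes "simple_function M X"
  shows "0 \<le> \<H>(X)"
  using conditional_entropy_nonneg[OF assms assms] conditional_entropy_less_eq_entropy[OF assms assms]
  by linarith

lemma entropy_Pair_le:
  assumes "simple_function M X" "simple_function M Y"
  shows "\<H>(\<lambda>x. (X x, Y x)) \<le> \<H>(X) + \<H>(Y)"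
  using entropy_chain_rule[OF assms] conditional_entropy_less_eq_entropy[OF assms(2,1)] by simp

text \<open>Apply \<open>f\<close> to the second coordinate of the pair only: the joint entropy
  cannot grow, and the chain rule cancels \<open>\<H>(X)\<close> on both sides.\<close>

lemma conditional_entropy_data_processing:
  assumes X: "simple_function M X" and Y: "simple_function M Y"
  shows "\<H>(f \<circ> Y | X) \<le> \<H>(Y | X)"
proof -
  have "\<H>((\<lambda>(u, v). (u, f v)) \<circ> (\<lambda>x. (X x, Y x))) \<le> \<H>(\<lambda>x. (X x, Y x))"
    by (rule entropy_data_processing[OF simple_function_Pair[OF X Y]])
  then have "\<H>(\<lambda>x. (X x, (f \<circ> Y) x)) \<le> \<H>(\<lambda>x. (X x, Y x))"
    by (simp add: comp_def)
  then show ?thesis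
    using entropy_chain_rule[OF X Y] entropy_chain_rule[OF X simple_function_compose[OF Y, of f]]
    by simp
qed

text \<open>Joint variables are coded as lists, so that families of every length share one type and
  can be extended one entry at a time.\<close>

lemma simple_function_map:
  assumes "\<And>i. i \<in> set js \<Longrightarrow> simple_function M (Y i)"
  shows "simple_function M (\<lambda>x. map (\<lambda>i. Y i x) js)"
  using assms
proof (induction js)
  case (Cons i js)
  then show ?case
    using simple_function_compose2[of M "Y i" "\<lambda>x. map (\<lambda>i. Y i x) js" "(#)"] by simp
qed simp

text \<open>Since \<open>l @ [y]\<close> and \<open>(l, y)\<close> determine each other, this is the
  chain rule for the pair.\<close>

lemma entropy_map_append:
  assumes "\<And>j. j \<in> set js \<Longrightarrow> simple_function M (Y j)" "simple_function M (Y i)"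
  shows "\<H>(\<lambda>x. map (\<lambda>j. Y j x) (js @ [i]))
    = \<H>(\<lambda>x. map (\<lambda>j. Y j x) js) + \<H>(Y i | (\<lambda>x. map (\<lambda>j. Y j x) js))"
proof -
  let ?X = "\<lambda>x. map (\<lambda>j. Y j x) js"
  note X = simple_function_map[of js Y, OF assms(1)]
  have "\<H>((\<lambda>(l, y). l @ [y]) \<circ> (\<lambda>x. (?X x, Y i x))) = \<H>(\<lambda>x. (?X x, Y i x))"
    by (rule entropy_of_inj[OF simple_function_Pair[OF X assms(2)]]) (auto simp: inj_on_def)
  then show ?thesis
    using entropy_chain_rule[OF X assms(2)] by (simp add: comp_def)
qed

lemma entropy_map_le:
  assumes "\<And>i. i \<in> set js \<Longrightarrow> simple_function M (Y i)"
  shows "\<H>(\<lambda>x. map (\<lambda>i. Y i x) js) \<le> (\<Sum>i\<leftarrow>js. \<H>(Y i))"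
  using assms
proof (induction js rule: rev_induct)
  case Nil
  \<comment> \<open>The empty list is a constant variable: its one value has probability 1, so its
    entropy is 0.\<close>
  have "simple_distributed M (\<lambda>x. [] :: 'c list) (\<lambda>_. 1)"
    by (rule simple_distributedI) (auto simp: prob_space)
  then show ?case by (simp add: entropy_simple_distributed)
next
  case (snoc i js)
  then have "\<H>(Y i | (\<lambda>x. map (\<lambda>j. Y j x) js)) \<le> \<H>(Y i)"
    by (intro conditional_entropy_less_eq_entropy simple_function_map) auto
  then show ?case
    using snoc entropy_map_append[of js Y i] by simp
qed

lemma simple_function_mem:
  assumes "B \<in> sets M"
  shows "simple_function M (\<lambda>x. x \<in> B)"
  unfolding simple_function_def
proof (intro conjI ballI)
  fix u
  have "(\<lambda>x. x \<in> B) -` {u} \<inter> space M = (if u then B else space M - B)"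
    using sets.sets_into_space[OF assms] by auto
  then show "(\<lambda>x. x \<in> B) -` {u} \<inter> space M \<in> sets M"
    using assms by auto
qed (rule finite_subset[of _ UNIV], auto)

text \<open>An event of small measure carries little entropy. The factor \<open>ln b\<close>
  converts logarithms to base \<open>b\<close> into natural ones.\<close>

lemma entropy_mem_le_sqrt:
  assumes D: "D \<in> sets M"
  shows "ln b * \<H>(\<lambda>x. x \<in> D) \<le> 2 * sqrt (prob D)"
proof -
  let ?p = "\<lambda>u. prob ((\<lambda>x. x \<in> D) -` {u} \<inter> space M)"
  have b: "ln b > 0" using b_gt_1 by simp
  have sd: "simple_distributed M (\<lambda>x. x \<in> D) ?p"
    by (rule simple_distributedI[OF simple_function_mem[OF D]]) auto
  have pT: "?p True = prob D"
    using sets.sets_into_space[OF D] by (auto intro!: arg_cong[where f = prob])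
  have "?p False = prob (space M - D)"
    by (auto intro!: arg_cong[where f = prob])
  then have pF: "?p False = 1 - prob D"
    using D by (simp add: prob_compl)
  have "\<H>(\<lambda>x. x \<in> D) = - (\<Sum>u\<in>(\<lambda>x. x \<in> D) ` space M. ?p u * log b (?p u))"
    by (rule entropy_simple_distributed[OF sd])
  \<comment> \<open>A truth value that is never attained has empty preimage and contributes 0, so
    both values may be included.\<close>
  also have "(\<Sum>u\<in>(\<lambda>x. x \<in> D) ` space M. ?p u * log b (?p u)) = (\<Sum>u\<in>UNIV. ?p u * log b (?p u))"
  proof (intro sum.mono_neutral_left ballI)
    fix u assume "u \<in> UNIV - (\<lambda>x. x \<in> D) ` space M"
    then have "(\<lambda>x. x \<in> D) -` {u} \<inter> space M = {}" by auto
    then show "?p u * log b (?p u) = 0" by (simp only: measure_empty mult_zero_left)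
  qed auto
  also have "\<dots> = prob D * log b (prob D) + (1 - prob D) * log b (1 - prob D)"
    by (simp add: UNIV_bool pT pF)
  finally have "ln b * \<H>(\<lambda>x. x \<in> D) = - (prob D * ln (prob D)) - (1 - prob D) * ln (1 - prob D)"
    using b by (simp add: log_def field_simps)
  then show ?thesis
    using binary_entropy_le_sqrt[of "prob D"] by simp
qed

text \<open>Rounding the conditional probabilities of \<open>B\<close> given \<open>X\<close> to \<open>0\<close> or \<open>1\<close> yields the set \<open>Z\<close>.\<close>

lemma ex_approx_le_conditional_entropy:
  assumes X: "simple_function M X" and B: "B \<in> sets M"
  shows "\<exists>Z \<subseteq> X ` space M. prob (sym_diff B (X -` Z \<inter> space M)) \<le> ln b * \<H>((\<lambda>x. x \<in> B) | X)"
proof -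
  let ?U = "X ` space M"
  define C where "C y = X -` {y} \<inter> space M" for y
  define p q where "p y = prob (C y \<inter> B)" and "q y = prob (C y - B)" for y
  \<comment> \<open>Majority vote on each level set of \<open>X\<close>: the error made there is
    exactly the smaller of \<open>p y\<close> and \<open>q y\<close>.\<close>
  define Z where "Z = {y \<in> ?U. q y \<le> p y}"
  have b: "ln b > 0" using b_gt_1 by simp
  have fin: "finite ?U" and C: "C y \<in> sets M" for y
    using X by (auto simp: simple_function_def C_def intro: simple_functionD)
  have pq: "prob (C y) = p y + q y" for y
    unfolding p_def q_def using B C[of y]
    by (subst finite_measure_Union[symmetric]) (auto intro!: arg_cong[where f = prob])
  let ?Y = "\<lambda>x. (x \<in> B, X x)"
  let ?P = "\<lambda>z. prob (?Y -` {z} \<inter> space M)"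
  have PT: "?P (True, y) = p y" and PF: "?P (False, y) = q y" for y
    by (auto simp: p_def q_def C_def intro!: arg_cong[where f = prob])
  have "\<H>((\<lambda>x. x \<in> B) | X) = - (\<Sum>(u, y)\<in>?Y ` space M. ?P (u, y) * log b (?P (u, y) / prob (C y)))"
    by (intro conditional_entropy_eq simple_distributedI X simple_function_Pair simple_function_mem B)
       (auto simp: C_def)
  also have "(\<Sum>(u, y)\<in>?Y ` space M. ?P (u, y) * log b (?P (u, y) / prob (C y)))
      = (\<Sum>(u, y)\<in>UNIV \<times> ?U. ?P (u, y) * log b (?P (u, y) / prob (C y)))"
  proof (intro sum.mono_neutral_left ballI)
    fix z assume "z \<in> UNIV \<times> ?U - ?Y ` space M"
    then have "?Y -` {z} \<inter> space M = {}" by auto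
    then have "?P z = 0" by (simp only: measure_empty)
    then show "(case z of (u, y) \<Rightarrow> ?P (u, y) * log b (?P (u, y) / prob (C y))) = 0"
      by (cases z) (simp only: prod.case mult_zero_left)
  qed (use fin in auto)
  also have "\<dots> = (\<Sum>u\<in>UNIV. \<Sum>y\<in>?U. ?P (u, y) * log b (?P (u, y) / prob (C y)))"
    by (simp only: sum.cartesian_product)
  also have "\<dots> = (\<Sum>y\<in>?U. p y * log b (p y / (p y + q y)) + q y * log b (q y / (p y + q y)))"
    by (simp only: UNIV_bool sum.insert finite.intros PT PF pq sum.distrib) (simp add: PT PF add.commute)
  finally have H: "ln b * \<H>((\<lambda>x. x \<in> B) | X)
      = (\<Sum>y\<in>?U. - (p y * ln (p y / (p y + q y))) - q y * ln (q y / (p y + q y)))"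
    using b by (simp add: log_def sum_distrib_left sum_negf[symmetric] algebra_simps)
  have "prob (sym_diff B (X -` Z \<inter> space M))
      = prob (\<Union>y\<in>?U. if y \<in> Z then C y - B else C y \<inter> B)"
    using sets.sets_into_space[OF B]
    by (intro arg_cong[where f = prob]) (auto simp: C_def Z_def split: if_splits)
  also have "\<dots> \<le> (\<Sum>y\<in>?U. prob (if y \<in> Z then C y - B else C y \<inter> B))"
    using B C by (intro finite_measure_subadditive_finite fin) auto
  also have "\<dots> = (\<Sum>y\<in>?U. min (p y) (q y))"
    by (intro sum.cong) (auto simp: Z_def p_def q_def)
  also have "\<dots> \<le> ln b * \<H>((\<lambda>x. x \<in> B) | X)"
    unfolding H by (intro sum_mono min_le_binary_entropy) (auto simp: p_def q_def)
  finally show ?thesis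
    by (intro exI[of _ Z]) (auto simp: Z_def)
qed

end

section \<open>Totally bounded families in the measure algebra\<close>

context prob_space
begin

lemma prob_sym_diff_triangle:
  assumes "A \<in> sets M" "B \<in> sets M" "C \<in> sets M"
  shows "prob (sym_diff A C) \<le> prob (sym_diff A B) + prob (sym_diff B C)"
proof -
  have "prob (sym_diff A C) \<le> prob (sym_diff A B \<union> sym_diff B C)"
    using assms by (intro finite_measure_mono) auto
  also have "\<dots> \<le> prob (sym_diff A B) + prob (sym_diff B C)"
    using assms by (intro measure_Un_le) auto
  finally show ?thesis .
qed

text \<open>Along a subsequence with summable consecutive distances, the limit is the set of points
  that eventually belong to the sequence.\<close>

lemma sym_diff_Cauchy_imp_convergent:
  assumes A: "\<And>n. A n \<in> sets M"
    and Cauchy: "\<And>e. 0 < e \<Longrightarrow> \<exists>N. \<forall>m\<ge>N. \<forall>n\<ge>N. prob (sym_diff (A m) (A n)) < e"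
  shows "\<exists>L\<in>sets M. (\<lambda>n. prob (sym_diff (A n) L)) \<longlonglongrightarrow> 0"
proof -
  have "\<forall>k. \<exists>N. \<forall>m\<ge>N. \<forall>n\<ge>N. prob (sym_diff (A m) (A n)) < (1/2) ^ k"
    by (intro allI Cauchy) simp
  then obtain N where N: "\<And>k m n. N k \<le> m \<Longrightarrow> N k \<le> n \<Longrightarrow> prob (sym_diff (A m) (A n)) < (1/2) ^ k"
    by metis
  \<comment> \<open>Partial sums make the subsequence of indices monotone while keeping
    \<open>r k\<close> at least \<open>N k\<close>.\<close>
  define r where "r k = (\<Sum>i\<le>k. N i)" for k
  have r: "N k \<le> r k" "r k \<le> r (Suc k)" for k
    by (auto simp: r_def intro: member_le_sum)
  define B where "B = (\<lambda>k. A (r k))"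
  define D where "D k = sym_diff (B k) (B (Suc k))" for k
  have B: "B k \<in> sets M" for k by (simp add: B_def A)
  have D: "D k \<in> sets M" for k
    unfolding D_def by (intro sets.Un sets.Diff B)
  have D_le: "prob (D k) \<le> (1/2) ^ k" for k
    using N[of k "r k" "r (Suc k)"] r[of k] by (simp add: D_def B_def)
  define L where "L = (\<Union>k. \<Inter>j\<in>{k..}. B j)"
  have L: "L \<in> sets M" unfolding L_def by (intro sets.countable_UN sets.countable_INT') (auto simp: B)
  \<comment> \<open>A point outside every later \<open>D j\<close> never changes membership after
    index \<open>k\<close>, so it lies in \<open>L\<close> iff it lies in
    \<open>B k\<close>.\<close>
  have sub: "sym_diff (B k) L \<subseteq> (\<Union>j. D (j + k))" for k
  proof
    fix x assume x: "x \<in> sym_diff (B k) L"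
    show "x \<in> (\<Union>j. D (j + k))"
    proof (rule ccontr)
      assume "x \<notin> (\<Union>j. D (j + k))"
      then have step: "x \<in> B (j + k) \<longleftrightarrow> x \<in> B (Suc (j + k))" for j
        by (auto simp: D_def)
      have same: "x \<in> B (j + k) \<longleftrightarrow> x \<in> B k" for j
        by (induction j) (use step in auto)
      have tail: "x \<in> B j \<longleftrightarrow> x \<in> B k" if "k \<le> j" for j
        using same[of "j - k"] that by simp
      have "x \<in> L \<longleftrightarrow> x \<in> B k"
      proof
        assume "x \<in> L"
        then obtain m where "\<And>j. m \<le> j \<Longrightarrow> x \<in> B j" by (auto simp: L_def)
        then show "x \<in> B k" using tail[of "max m k"] by (metis max.cobounded1 max.cobounded2)
      next
        assume "x \<in> B k"
        then have "x \<in> (\<Inter>j\<in>{k..}. B j)" using tail by blast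
        then show "x \<in> L" unfolding L_def by blast
      qed
      then show False using x by auto
    qed
  qed
  have BL: "prob (sym_diff (B k) L) \<le> 2 * (1/2) ^ k" for k
  proof -
    have s: "(\<lambda>j. (1/2 :: real) ^ (j + k)) sums (2 * (1/2) ^ k)"
      using sums_mult2[OF geometric_sums[of "1/2 :: real"], of "(1/2) ^ k"] by (simp add: power_add)
    have sD: "summable (\<lambda>j. prob (D (j + k)))"
      using D_le by (intro summable_comparison_test'[OF sums_summable[OF s]]) auto
    have "prob (sym_diff (B k) L) \<le> prob (\<Union>j. D (j + k))"
      using sub D by (intro finite_measure_mono) auto
    also have "\<dots> \<le> (\<Sum>j. prob (D (j + k)))"
      using sD D by (intro finite_measure_subadditive_countably) auto
    also have "\<dots> \<le> 2 * (1/2) ^ k"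
      using suminf_le[OF D_le sD sums_summable[OF s]] sums_unique[OF s] by simp
    finally show ?thesis .
  qed
  have "(\<lambda>n. prob (sym_diff (A n) L)) \<longlonglongrightarrow> 0"
  proof (rule LIMSEQ_I)
    fix e :: real assume "0 < e"
    \<comment> \<open>One share of \<open>e / 3\<close> pays for the distance from
      \<open>A n\<close> to \<open>B k\<close>, two for the distance from \<open>B k\<close> to
      \<open>L\<close>.\<close>
    then obtain k where k: "(1/2 :: real) ^ k < e / 3"
      using real_arch_pow_inv[of "e / 3" "1/2"] by auto
    have "prob (sym_diff (A n) L) < e" if "r k \<le> n" for n
    proof -
      have "prob (sym_diff (A n) (B k)) < (1/2) ^ k"
        using N[of k n "r k"] r[of k] that by (simp add: B_def)
      then show ?thesis
        using prob_sym_diff_triangle[OF A[of n] B[of k] L] BL[of k] k by linarith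
    qed
    then show "\<exists>no. \<forall>n\<ge>no. norm (prob (sym_diff (A n) L) - 0) < e"
      by auto
  qed
  with L show ?thesis by blast
qed

section \<open>Classes of indicators as a complete subspace of L2\<close>

lemma indicator_mem_L2: "A \<in> sets M \<Longrightarrow> indicator A \<in> L2_functions M"
  by (auto simp: L2_functions_def intro!: integrable_const_bound[where B = 1] split: split_indicator)

text \<open>The squared difference of two indicators is the indicator of the symmetric difference.
  Questions about L2 orbits thereby become questions about measures of sets.\<close>

lemma L2_dist_indicator:
  assumes "A \<in> sets M" "B \<in> sets M"
  shows "L2_dist M (L2_class M (indicator A)) (L2_class M (indicator B)) = sqrt (prob (sym_diff A B))"
proof -
  have "(\<integral>x. (indicator A x - indicator B x :: real)\<^sup>2 \<partial>M) = (\<integral>x. indicator (sym_diff A B) x \<partial>M)"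
    by (intro Bochner_Integration.integral_cong) (auto split: split_indicator)
  also have "\<dots> = prob (sym_diff A B)"
    using assms sets.sets_into_space[of _ M]
    by (subst Bochner_Integration.integral_indicator)
       (auto intro!: arg_cong[where f = prob])
  finally show ?thesis
    using assms by (simp add: L2_dist_class indicator_mem_L2)
qed

text \<open>Completeness turns total boundedness into compactness of the closure. On indicator
  classes it reduces to convergence of Cauchy sequences of sets.\<close>

lemma mcomplete_indicators:
  "Metric_space.mcomplete ((\<lambda>A. L2_class M (indicator A)) ` sets M) (L2_dist M)"
proof -
  let ?c = "\<lambda>A. L2_class M (indicator A)"
  interpret Metric_space "?c ` sets M" "L2_dist M"
    by (rule Metric_space.subspace[OF Metric_space_L2]) (auto intro: L2_class_in_space indicator_mem_L2)
  show ?thesis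
    unfolding mcomplete_def
  proof (intro allI impI)
    fix \<sigma> assume \<sigma>: "MCauchy \<sigma>"
    then have "range \<sigma> \<subseteq> ?c ` sets M"
      by (simp add: MCauchy_def)
    then have "\<forall>n. \<exists>A\<in>sets M. \<sigma> n = ?c A"
      by (simp add: image_subset_iff image_iff)
    then obtain A where A: "\<And>n. A n \<in> sets M" and \<sigma>A: "\<And>n. \<sigma> n = ?c (A n)"
      by metis
    have "\<exists>L\<in>sets M. (\<lambda>n. prob (sym_diff (A n) L)) \<longlonglongrightarrow> 0"
    proof (rule sym_diff_Cauchy_imp_convergent[OF A])
      fix e :: real assume "0 < e"
      then have "\<exists>N. \<forall>m n. N \<le> m \<longrightarrow> N \<le> n \<longrightarrow> L2_dist M (\<sigma> m) (\<sigma> n) < sqrt e"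
        using \<sigma> unfolding MCauchy_def by simp
      then show "\<exists>N. \<forall>m\<ge>N. \<forall>n\<ge>N. prob (sym_diff (A m) (A n)) < e"
        by (simp add: \<sigma>A L2_dist_indicator A)
    qed
    then obtain L where L: "L \<in> sets M" "(\<lambda>n. prob (sym_diff (A n) L)) \<longlonglongrightarrow> 0" by blast
    have "(\<lambda>n. L2_dist M (\<sigma> n) (?c L)) \<longlonglongrightarrow> 0"
      using tendsto_real_sqrt[OF L(2)] by (simp add: \<sigma>A L2_dist_indicator A L(1))
    then have "limitin mtopology \<sigma> (?c L) sequentially"
      using L(1) A by (auto simp: limitin_metric_dist_null \<sigma>A)
    then show "\<exists>x. limitin mtopology \<sigma> x sequentially" by blast
  qed
qed

text \<open>In the complete subspace of indicator classes, compact closure means total boundedness.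
  The rest transfers compactness between the closures taken in that subspace and in all of
  L2.\<close>

lemma compactin_closure_indicators_iff:
  assumes C: "C \<subseteq> sets M"
  shows "compactin (mtopology_of (L2_metric M))
      (mtopology_of (L2_metric M) closure_of (\<lambda>A. L2_class M (indicator A)) ` C)
    \<longleftrightarrow> (\<forall>e>0. \<exists>F\<subseteq>C. finite F \<and> (\<forall>A\<in>C. \<exists>B\<in>F. prob (sym_diff A B) < e))"
    (is "compactin ?X (?X closure_of ?c ` C) \<longleftrightarrow> ?tb")
proof -
  interpret Submetric "L2_space M" "L2_dist M" "?c ` sets M"
    by (intro Submetric.intro Metric_space_L2 Submetric_axioms.intro)
       (auto intro: L2_class_in_space indicator_mem_L2)
  have X: "?X = mtopology"
    by (simp add: L2_metric_def mtopology_of)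
  have cC: "?c ` C \<subseteq> ?c ` sets M" using C by auto
  \<comment> \<open>Distances are square roots of measures, so the radius \<open>sqrt e\<close>
    corresponds to the tolerance \<open>e\<close>.\<close>
  have close: "?c A \<in> sub.mball (?c B) (sqrt e) \<longleftrightarrow> prob (sym_diff A B) < e"
    if "A \<in> C" "B \<in> C" for A B e
    using that C by (auto simp: sub.in_mball L2_dist_indicator subset_iff Un_commute)
  have net: "(\<exists>K. finite K \<and> K \<subseteq> ?c ` C \<and> ?c ` C \<subseteq> (\<Union>x\<in>K. sub.mball x (sqrt e)))
      \<longleftrightarrow> (\<exists>F\<subseteq>C. finite F \<and> (\<forall>A\<in>C. \<exists>B\<in>F. prob (sym_diff A B) < e))" for e
  proof safe
    fix K assume K: "finite K" "K \<subseteq> ?c ` C" "?c ` C \<subseteq> (\<Union>x\<in>K. sub.mball x (sqrt e))"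
    obtain F where F: "F \<subseteq> C" "finite F" "K = ?c ` F"
      using finite_subset_image[OF K(1,2)] by blast
    have "\<exists>B\<in>F. prob (sym_diff A B) < e" if "A \<in> C" for A
    proof -
      have "?c A \<in> (\<Union>x\<in>K. sub.mball x (sqrt e))" using K(3) that by blast
      then obtain B where "B \<in> F" "?c A \<in> sub.mball (?c B) (sqrt e)" using F(3) by blast
      then show ?thesis using close[of A B e] that F(1) by blast
    qed
    with F show "\<exists>F\<subseteq>C. finite F \<and> (\<forall>A\<in>C. \<exists>B\<in>F. prob (sym_diff A B) < e)" by blast
  next
    fix F assume F: "F \<subseteq> C" "finite F" "\<forall>A\<in>C. \<exists>B\<in>F. prob (sym_diff A B) < e"
    have "?c ` C \<subseteq> (\<Union>x\<in>?c ` F. sub.mball x (sqrt e))"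
    proof (rule image_subsetI)
      fix A assume "A \<in> C"
      then obtain B where "B \<in> F" "prob (sym_diff A B) < e" using F(3) by blast
      then show "?c A \<in> (\<Union>x\<in>?c ` F. sub.mball x (sqrt e))"
        using close[of A B e] \<open>A \<in> C\<close> F(1) by blast
    qed
    then show "\<exists>K. finite K \<and> K \<subseteq> ?c ` C \<and> ?c ` C \<subseteq> (\<Union>x\<in>K. sub.mball x (sqrt e))"
      using F(1,2) by (intro exI[of _ "?c ` F"]) auto
  qed
  have tb: "sub.mtotally_bounded (?c ` C) \<longleftrightarrow> ?tb"
  proof
    assume "sub.mtotally_bounded (?c ` C)"
    then show ?tb
      using net unfolding sub.mtotally_bounded_def by (meson real_sqrt_gt_zero)
  next
    assume R: ?tb
    show "sub.mtotally_bounded (?c ` C)"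
      unfolding sub.mtotally_bounded_def
    proof (intro allI impI)
      fix e :: real assume "0 < e"
      then show "\<exists>K. finite K \<and> K \<subseteq> ?c ` C \<and> ?c ` C \<subseteq> (\<Union>x\<in>K. sub.mball x e)"
        using R net[of "e\<^sup>2"] by simp
    qed
  qed
  have "compactin mtopology (mtopology closure_of ?c ` C)
      \<longleftrightarrow> compactin sub.mtopology (sub.mtopology closure_of ?c ` C)"
  proof
    assume "compactin mtopology (mtopology closure_of ?c ` C)"
    then have "mtotally_bounded (?c ` C)"
      using cC subset by (intro compact_closure_of_imp_mtotally_bounded) auto
    then have "sub.mtotally_bounded (?c ` C)"
      using mtotally_bounded_submetric cC subset by blast
    then show "compactin sub.mtopology (sub.mtopology closure_of ?c ` C)"
      using sub.mtotally_bounded_eq_compact_closure_of[OF mcomplete_indicators] by blast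
  next
    assume "compactin sub.mtopology (sub.mtopology closure_of ?c ` C)"
    then have K: "compactin mtopology (sub.mtopology closure_of ?c ` C)"
      by (simp add: mtopology_submetric compactin_subtopology)
    \<comment> \<open>The closure in the subspace is compact, hence closed in the Hausdorff space
      L2, and so it contains the closure taken there.\<close>
    have "?c ` C \<subseteq> sub.mtopology closure_of ?c ` C"
      using cC by (intro closure_of_subset) simp
    then have "mtopology closure_of ?c ` C \<subseteq> sub.mtopology closure_of ?c ` C"
      using compactin_imp_closedin[OF Hausdorff_space_mtopology K] by (rule closure_of_minimal)
    then show "compactin mtopology (mtopology closure_of ?c ` C)"
      using K closed_compactin closedin_closure_of by blast
  qed
  also have "\<dots> \<longleftrightarrow> ?tb"
    using sub.mtotally_bounded_eq_compact_closure_of[OF mcomplete_indicators] cC tb by blast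
  finally show ?thesis by (simp add: X)
qed

end

section \<open>Entropy of partitions and of finite nets\<close>

text \<open>Once partitions are level sets of maps, refining them amounts to forming the joint map.
  This links refinements of partitions to joint random variables.\<close>

lemma common_refinement_fibres:
  assumes "I \<noteq> {}" and P: "\<And>i. i \<in> I \<Longrightarrow> P i = (\<lambda>x. {y \<in> \<Omega>. Y i y = Y i x}) ` \<Omega>"
  shows "common_refinement (P ` I) = (\<lambda>x. {y \<in> \<Omega>. \<forall>i\<in>I. Y i y = Y i x}) ` \<Omega>"
proof (intro equalityI subsetI)
  fix U assume "U \<in> common_refinement (P ` I)"
  then obtain f where f: "\<And>i. i \<in> I \<Longrightarrow> f (P i) \<in> P i" and U: "U = (\<Inter>i\<in>I. f (P i))" and "U \<noteq> {}"
    by (auto simp: common_refinement Pi_iff)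
  \<comment> \<open>A single point of \<open>U\<close> already determines the block chosen from
    every partition.\<close>
  then obtain x where x: "\<And>i. i \<in> I \<Longrightarrow> x \<in> f (P i)" by blast
  have fx: "x \<in> \<Omega> \<and> f (P i) = {y \<in> \<Omega>. Y i y = Y i x}" if i: "i \<in> I" for i
  proof -
    obtain z where "f (P i) = {y \<in> \<Omega>. Y i y = Y i z}" using f[OF i] P[OF i] by auto
    then show ?thesis using x[OF i] by auto
  qed
  then have "U = {y \<in> \<Omega>. \<forall>i\<in>I. Y i y = Y i x}"
    using \<open>I \<noteq> {}\<close> by (auto simp: U)
  then show "U \<in> (\<lambda>x. {y \<in> \<Omega>. \<forall>i\<in>I. Y i y = Y i x}) ` \<Omega>"
    using fx \<open>I \<noteq> {}\<close> by blast
next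
  fix U assume "U \<in> (\<lambda>x. {y \<in> \<Omega>. \<forall>i\<in>I. Y i y = Y i x}) ` \<Omega>"
  then obtain x where x: "x \<in> \<Omega>" and U: "U = {y \<in> \<Omega>. \<forall>i\<in>I. Y i y = Y i x}" by blast
  \<comment> \<open>The block of \<open>Q\<close> around \<open>x\<close>, given as a union of
    blocks. The choice depends on the partition rather than on an index, so \<open>P\<close> may
    repeat values.\<close>
  define f where "f Q = {y. \<exists>V\<in>Q. x \<in> V \<and> y \<in> V}" for Q
  have f: "f (P i) = {y \<in> \<Omega>. Y i y = Y i x}" if "i \<in> I" for i
    using x by (auto simp: f_def P[OF that])
  have "f \<in> (\<Pi> Q\<in>P ` I. Q)"
    using x by (auto simp: f) (auto simp: P)
  moreover have "U = \<Inter> (f ` P ` I)"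
    using \<open>I \<noteq> {}\<close> by (auto simp: U f)
  moreover have "x \<in> U" using x by (simp add: U)
  ultimately show "U \<in> common_refinement (P ` I)"
    unfolding common_refinement by blast
qed

context information_space
begin

text \<open>The level sets correspond bijectively to the attained values of \<open>X\<close>;
  \<open>ln b\<close> accounts for the base of the logarithm.\<close>

lemma partition_entropy_fibres:
  assumes X: "simple_function M X"
  shows "partition_entropy M ((\<lambda>x. {y \<in> space M. X y = X x}) ` space M) = ln b * \<H>(X)"
proof -
  let ?C = "\<lambda>u. X -` {u} \<inter> space M"
  have b: "ln b > 0" using b_gt_1 by simp
  have "(\<lambda>x. {y \<in> space M. X y = X x}) ` space M = ?C ` X ` space M"
    unfolding image_image by (intro image_cong) auto
  moreover have "inj_on ?C (X ` space M)"
    by (auto simp: inj_on_def)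
  ultimately have "partition_entropy M ((\<lambda>x. {y \<in> space M. X y = X x}) ` space M)
      = - (\<Sum>u\<in>X ` space M. prob (?C u) * ln (prob (?C u)))"
    by (simp add: partition_entropy_def sum.reindex)
  also have "\<dots> = ln b * \<H>(X)"
    using b by (simp add: entropy_simple_distributed[OF simple_distributedI[OF X measure_nonneg refl]]
        log_def sum_distrib_left)
  finally show ?thesis .
qed

text \<open>By pigeonhole: only finitely many sets are measurable with respect to \<open>X\<close>.\<close>

lemma small_conditional_entropy_imp_finite_net:
  assumes X: "simple_function M X"
    and B: "\<And>i. i \<in> I \<Longrightarrow> B i \<in> sets M"
    and small: "\<And>i. i \<in> I \<Longrightarrow> ln b * \<H>((\<lambda>x. x \<in> B i) | X) < c"
  shows "\<exists>F\<subseteq>I. finite F \<and> (\<forall>i\<in>I. \<exists>j\<in>F. prob (sym_diff (B i) (B j)) < 2 * c)"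
proof -
  let ?V = "\<lambda>Z. X -` Z \<inter> space M"
  have "\<forall>i\<in>I. \<exists>Z \<subseteq> X ` space M. prob (sym_diff (B i) (?V Z)) < c"
    using ex_approx_le_conditional_entropy[OF X] B small by (meson le_less_trans)
  then obtain Z where Z: "\<And>i. i \<in> I \<Longrightarrow> Z i \<subseteq> X ` space M"
    and close: "\<And>i. i \<in> I \<Longrightarrow> prob (sym_diff (B i) (?V (Z i))) < c"
    by metis
  have V: "?V U \<in> sets M" for U
    using X by (rule simple_functionD)
  have "finite (Z ` I)"
    using Z X by (intro finite_subset[of "Z ` I" "Pow (X ` space M)"]) (auto simp: simple_functionD)
  \<comment> \<open>\<open>inv_into I Z\<close> picks one index for each rounded set. Two indices
    with the same rounded set are each within \<open>c\<close> of it, which gives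
    \<open>2 * c\<close>.\<close>
  moreover have "\<exists>j\<in>inv_into I Z ` Z ` I. prob (sym_diff (B i) (B j)) < 2 * c" if i: "i \<in> I" for i
  proof
    let ?j = "inv_into I Z (Z i)"
    show "?j \<in> inv_into I Z ` Z ` I" using i by blast
    have j: "?j \<in> I" "Z ?j = Z i" using i by (auto intro: inv_into_into simp: f_inv_into_f)
    have "prob (sym_diff (B i) (B ?j)) \<le> prob (sym_diff (B i) (?V (Z i))) + prob (sym_diff (?V (Z i)) (B ?j))"
      using i j by (intro prob_sym_diff_triangle B V)
    also have "sym_diff (?V (Z i)) (B ?j) = sym_diff (B ?j) (?V (Z ?j))"
      using j by auto
    also have "prob (sym_diff (B i) (?V (Z i))) + prob (sym_diff (B ?j) (?V (Z ?j))) < 2 * c"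
      using close[OF i] close[OF j(1)] by simp
    finally show "prob (sym_diff (B i) (B ?j)) < 2 * c" .
  qed
  ultimately show ?thesis
    by (intro exI[of _ "inv_into I Z ` Z ` I"]) (auto intro: inv_into_into)
qed

text \<open>Each \<open>B i\<close> is recovered from a net element and a small difference
  \<open>D i\<close>. The net contributes an amount that does not depend on \<open>js\<close>, and
  each difference at most \<open>2 * sqrt e\<close>.\<close>

lemma entropy_map_mem_le_net:
  assumes B: "\<And>i. i \<in> set js \<Longrightarrow> B i \<in> sets M"
    and W: "set Ws \<subseteq> sets M"
    and near: "\<And>i. i \<in> set js \<Longrightarrow> \<exists>W\<in>set Ws. prob (sym_diff (B i) W) \<le> e"
  shows "ln b * \<H>(\<lambda>x. map (\<lambda>i. x \<in> B i) js)
    \<le> ln b * \<H>(\<lambda>x. map (\<lambda>W. x \<in> W) Ws) + 2 * sqrt e * length js"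
proof -
  have b: "ln b > 0" using b_gt_1 by simp
  have "\<forall>i\<in>set js. \<exists>n<length Ws. prob (sym_diff (B i) (Ws ! n)) \<le> e"
    using near by (metis in_set_conv_nth)
  then obtain r where r: "\<And>i. i \<in> set js \<Longrightarrow> r i < length Ws"
    and e: "\<And>i. i \<in> set js \<Longrightarrow> prob (sym_diff (B i) (Ws ! r i)) \<le> e"
    by metis
  define D where "D i = sym_diff (B i) (Ws ! r i)" for i
  have D: "D i \<in> sets M" if "i \<in> set js" for i
    using B[OF that] W r[OF that] by (auto simp: D_def intro!: sets.Un sets.Diff dest!: nth_mem)
  let ?W = "\<lambda>x. map (\<lambda>W. x \<in> W) Ws" and ?D = "\<lambda>x. map (\<lambda>i. x \<in> D i) js"
  have sW: "simple_function M ?W"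
    using W by (intro simple_function_map simple_function_mem) auto
  have sD: "simple_function M ?D"
    using D by (intro simple_function_map simple_function_mem) auto
  \<comment> \<open>Exclusive or: a point lies in \<open>B i\<close> iff its memberships in
    \<open>Ws ! r i\<close> and \<open>D i\<close> differ.\<close>
  let ?f = "\<lambda>(u, d). map2 (\<lambda>i z. (u ! r i) \<noteq> z) js d"
  have eq: "(\<lambda>x. map (\<lambda>i. x \<in> B i) js) = ?f \<circ> (\<lambda>x. (?W x, ?D x))"
    using r by (auto simp: fun_eq_iff D_def zip_map2 zip_same_conv_map)
  have "\<H>(\<lambda>x. map (\<lambda>i. x \<in> B i) js) \<le> \<H>(\<lambda>x. (?W x, ?D x))"
    unfolding eq by (rule entropy_data_processing[OF simple_function_Pair[OF sW sD]])
  also have "\<dots> \<le> \<H>(?W) + (\<Sum>i\<leftarrow>js. \<H>(\<lambda>x. x \<in> D i))"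
    using entropy_Pair_le[OF sW sD] entropy_map_le[of js "\<lambda>i x. x \<in> D i", OF simple_function_mem[OF D]] by simp
  finally have "ln b * \<H>(\<lambda>x. map (\<lambda>i. x \<in> B i) js) \<le> ln b * (\<H>(?W) + (\<Sum>i\<leftarrow>js. \<H>(\<lambda>x. x \<in> D i)))"
    using b by simp
  also have "\<dots> = ln b * \<H>(?W) + (\<Sum>i\<leftarrow>js. ln b * \<H>(\<lambda>x. x \<in> D i))"
    by (simp add: distrib_left sum_list_const_mult)
  also have "(\<Sum>i\<leftarrow>js. ln b * \<H>(\<lambda>x. x \<in> D i)) \<le> (\<Sum>i\<leftarrow>js. 2 * sqrt e)"
  proof (rule sum_list_mono)
    fix i assume i: "i \<in> set js"
    have "2 * sqrt (prob (D i)) \<le> 2 * sqrt e" using e[OF i] by (simp add: D_def)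
    then show "ln b * \<H>(\<lambda>x. x \<in> D i) \<le> 2 * sqrt e"
      using entropy_mem_le_sqrt[OF D[OF i]] by linarith
  qed
  finally show ?thesis by (simp add: sum_list_triv mult.commute)
qed

end

section \<open>Translates along the strip\<close>

text \<open>With base \<open>exp 1\<close> the factors \<open>ln b\<close> above become 1, matching
  the natural logarithm in \<open>partition_entropy\<close>.\<close>

sublocale Z2_mpds \<subseteq> information_space M "exp 1"
  by standard simp

context Z2_mpds
begin

notation entropy_Pow (\<open>\<H>'(_')\<close>)
notation conditional_entropy_Pow (\<open>\<H>'(_ | _')\<close>)

lemma space_eq_UNIV: "space M = UNIV"
  using sets_eq_imp_space_eq[OF sets_M] by simp

text \<open>Additivity makes \<open>T 0\<close> idempotent, and an injective idempotent map is the
  identity.\<close>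

lemma T_zero: "T 0 x = x"
proof -
  obtain g where "homeomorphism UNIV UNIV (T 0) g" using T_homeo by blast
  then have "g (T 0 y) = y" for y by (simp add: homeomorphism_def)
  moreover have "T 0 (T 0 x) = T 0 x"
    using T_add[of 0 0] by (simp add: fun_eq_iff)
  ultimately show ?thesis by metis
qed

lemma T_uminus: "T v (T (- v) x) = x" "T (- v) (T v x) = x"
  using T_add[of v "- v"] T_add[of "- v" v] by (simp_all add: fun_eq_iff T_zero)

lemma image_T_uminus: "T (- v) ` A = T v -` A"
  by (force simp: T_uminus)

lemma sets_vimage_T: "A \<in> sets M \<Longrightarrow> T v -` A \<in> sets M"
  using measurable_sets[OF T_measurable, of A v] by (simp add: space_eq_UNIV)

lemma directional_Kronecker_iff:
  assumes "0 < b"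
  shows "B \<in> directional_Kronecker M T \<beta> \<longleftrightarrow> B \<in> sets M \<and>
    (\<forall>e>0. \<exists>F\<subseteq>strip \<beta> b. finite F \<and>
      (\<forall>v\<in>strip \<beta> b. \<exists>w\<in>F. prob (sym_diff (T v -` B) (T w -` B)) < e))"
proof (cases "B \<in> sets M")
  case True
  let ?V = "\<lambda>v. T v -` B"
  have "strip_orbit M T \<beta> b B = (\<lambda>A. L2_class M (indicator A)) ` ?V ` strip \<beta> b"
    unfolding strip_orbit_def image_image
    by (intro image_cong refl arg_cong[where f = "L2_class M"])
       (auto simp: koopman_def indicator_def fun_eq_iff)
  moreover have "?V ` strip \<beta> b \<subseteq> sets M"
    using True sets_vimage_T by blast
  \<comment> \<open>Nets of sets are traded for nets of lattice vectors, the form that later choices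
    of vectors use.\<close>
  moreover have "(\<exists>F\<subseteq>?V ` strip \<beta> b. finite F \<and> (\<forall>A\<in>?V ` strip \<beta> b. \<exists>C\<in>F. prob (sym_diff A C) < e))
      \<longleftrightarrow> (\<exists>F\<subseteq>strip \<beta> b. finite F \<and> (\<forall>v\<in>strip \<beta> b. \<exists>w\<in>F. prob (sym_diff (?V v) (?V w)) < e))" for e
    using ex_finite_subset_image[of ?V "strip \<beta> b"
        "\<lambda>F. \<forall>v\<in>strip \<beta> b. \<exists>C\<in>F. prob (sym_diff (?V v) C) < e"]
    by (simp add: conj_ac)
  ultimately show ?thesis
    unfolding directional_Kronecker_width[OF assms] using True
    by (simp only: mem_Collect_eq compactin_closure_indicators_iff simp_thms)
qed (simp add: directional_Kronecker_def)

text \<open>For a partition this is the singleton of the block containing \<open>T v x\<close>;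
  collecting blocks gives a total map without a choice operator.\<close>

definition cell :: "'a set set \<Rightarrow> int \<times> int \<Rightarrow> 'a \<Rightarrow> 'a set set" where
  "cell \<alpha> v x = {A \<in> \<alpha>. T v x \<in> A}"

lemma cell_fibres:
  assumes \<alpha>: "finite_measurable_partition M \<alpha>"
  shows "translate_partition T v \<alpha> = (\<lambda>x. {y \<in> space M. cell \<alpha> v y = cell \<alpha> v x}) ` space M"
proof -
  have part: "\<exists>A\<in>\<alpha>. y \<in> A" "A \<in> \<alpha> \<Longrightarrow> A \<noteq> {}" "A \<in> \<alpha> \<Longrightarrow> C \<in> \<alpha> \<Longrightarrow> y \<in> A \<Longrightarrow> y \<in> C \<Longrightarrow> A = C" for y A C
    using \<alpha> unfolding finite_measurable_partition_def partition_on_def space_eq_UNIV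
    by (blast, blast, metis disjointD disjoint_iff)
  have fib: "T v -` A = {y \<in> space M. cell \<alpha> v y = cell \<alpha> v x}" if "A \<in> \<alpha>" "T v x \<in> A" for A x
    using that part unfolding cell_def space_eq_UNIV by blast
  show ?thesis
  proof (intro equalityI subsetI)
    fix U assume "U \<in> translate_partition T v \<alpha>"
    then obtain A where A: "A \<in> \<alpha>" "U = T v -` A"
      by (auto simp: translate_partition_def image_T_uminus)
    then obtain z where "z \<in> A" using part(2) by blast
    then have "T v (T (- v) z) \<in> A" by (simp add: T_uminus)
    from fib[OF A(1) this] A(2) show "U \<in> (\<lambda>x. {y \<in> space M. cell \<alpha> v y = cell \<alpha> v x}) ` space M"
      by (simp add: space_eq_UNIV)
  next
    fix U assume "U \<in> (\<lambda>x. {y \<in> space M. cell \<alpha> v y = cell \<alpha> v x}) ` space M"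
    then obtain x where U: "U = {y \<in> space M. cell \<alpha> v y = cell \<alpha> v x}" by blast
    obtain A where "A \<in> \<alpha>" "T v x \<in> A" using part(1) by blast
    with fib[OF this] U show "U \<in> translate_partition T v \<alpha>"
      by (auto simp: translate_partition_def image_T_uminus)
  qed
qed

lemma simple_function_cell:
  assumes \<alpha>: "finite_measurable_partition M \<alpha>"
  shows "simple_function M (cell \<alpha> v)"
  unfolding simple_function_def
proof (intro conjI ballI)
  have "cell \<alpha> v ` space M \<subseteq> Pow \<alpha>"
    by (auto simp: cell_def)
  moreover have "finite \<alpha>"
    using \<alpha> by (simp add: finite_measurable_partition_def)
  ultimately show "finite (cell \<alpha> v ` space M)"
    by (meson finite_Pow_iff finite_subset)
  fix u assume "u \<in> cell \<alpha> v ` space M"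
  then obtain x where "x \<in> space M" "u = cell \<alpha> v x" by blast
  then have "cell \<alpha> v -` {u} \<inter> space M = {y \<in> space M. cell \<alpha> v y = cell \<alpha> v x}"
    by auto
  with \<open>x \<in> space M\<close> have "cell \<alpha> v -` {u} \<inter> space M \<in> translate_partition T v \<alpha>"
    unfolding cell_fibres[OF \<alpha>] by blast
  then obtain A where "A \<in> \<alpha>" "cell \<alpha> v -` {u} \<inter> space M = T v -` A"
    unfolding translate_partition_def image_T_uminus by blast
  then show "cell \<alpha> v -` {u} \<inter> space M \<in> sets M"
    using \<alpha> sets_vimage_T[of A v] by (auto simp: finite_measurable_partition_def)
qed

text \<open>Equal translates collapse in the set of partitions but stay repeated in the list; the
  joint level sets are the same either way.\<close>

lemma partition_entropy_translates:
  assumes \<alpha>: "finite_measurable_partition M \<alpha>" and "0 < k"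
  shows "partition_entropy M (common_refinement ((\<lambda>i. translate_partition T (S i) \<alpha>) ` {..<k}))
    = \<H>(\<lambda>x. map (\<lambda>i. cell \<alpha> (S i) x) [0..<k])"
proof -
  let ?X = "\<lambda>x. map (\<lambda>i. cell \<alpha> (S i) x) [0..<k]"
  have "common_refinement ((\<lambda>i. translate_partition T (S i) \<alpha>) ` {..<k})
      = (\<lambda>x. {y \<in> space M. \<forall>i\<in>{..<k}. cell \<alpha> (S i) y = cell \<alpha> (S i) x}) ` space M"
    using \<open>0 < k\<close> by (intro common_refinement_fibres cell_fibres[OF \<alpha>]) auto
  also have "\<dots> = (\<lambda>x. {y \<in> space M. ?X y = ?X x}) ` space M"
    by (intro image_cong) (auto simp: map_eq_conv)
  finally show ?thesis
    using partition_entropy_fibres[OF simple_function_map[of "[0..<k]" "\<lambda>i. cell \<alpha> (S i)"]]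
      simple_function_cell[OF \<alpha>] by simp
qed

section \<open>Sequence entropy for sets inside and outside the Kronecker algebra\<close>

lemma finite_measurable_partition_Compl:
  assumes "B \<in> sets M" "B \<noteq> {}" "B \<noteq> UNIV"
  shows "finite_measurable_partition M {B, - B}"
proof -
  have "- B \<in> sets M"
    using sets.compl_sets[OF assms(1)] by (simp add: space_eq_UNIV Compl_eq_Diff_UNIV)
  moreover have "partition_on UNIV {B, - B}"
    using assms(2,3) by (intro partition_onI) (auto simp: disjnt_def)
  ultimately show ?thesis
    using assms(1) by (simp add: finite_measurable_partition_def space_eq_UNIV)
qed

text \<open>A finite net for the orbit costs a fixed entropy \<open>h\<close>, which vanishes after
  division by \<open>k\<close>, while every further step costs an arbitrarily small amount.\<close>

lemma sequence_entropy_directional_Kronecker: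
  assumes B: "B \<in> directional_Kronecker M T \<beta>" "B \<noteq> {}" "B \<noteq> UNIV"
    and "0 < b" and S: "range S \<subseteq> strip \<beta> b"
  shows "sequence_entropy M T S {B, - B} \<le> 0"
proof -
  have sB: "B \<in> sets M"
    using B(1) by (simp add: directional_Kronecker_def)
  note \<alpha> = finite_measurable_partition_Compl[OF sB B(2,3)]
  let ?H = "\<lambda>k. partition_entropy M (common_refinement ((\<lambda>i. translate_partition T (S i) {B, - B}) ` {..<k}))"
  have le: "sequence_entropy M T S {B, - B} \<le> ereal \<delta>" if "0 < \<delta>" for \<delta>
  proof -
    \<comment> \<open>Chosen so that the cost per step, \<open>2 * sqrt e\<close>, equals
      \<open>\<delta> / 2\<close>.\<close>
    define e where "e = (\<delta> / 4)\<^sup>2"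
    have "0 < e" using that by (simp add: e_def)
    then obtain F where F: "F \<subseteq> strip \<beta> b" "finite F"
      and net: "\<And>v. v \<in> strip \<beta> b \<Longrightarrow> \<exists>w\<in>F. prob (sym_diff (T v -` B) (T w -` B)) < e"
      using B(1) directional_Kronecker_iff[OF \<open>0 < b\<close>] by metis
    obtain ws where ws: "set ws = F" using F(2) finite_list by blast
    define Ws where "Ws = map (\<lambda>w. T w -` B) ws"
    define h where "h = \<H>(\<lambda>x. map (\<lambda>W. x \<in> W) Ws)"
    have bound: "?H k \<le> h + \<delta> / 2 * k" if "0 < k" for k
    proof -
      let ?X = "\<lambda>x. map (\<lambda>i. x \<in> T (S i) -` B) [0..<k]"
      have "?H k = \<H>(\<lambda>x. map (\<lambda>i. cell {B, - B} (S i) x) [0..<k])"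
        by (rule partition_entropy_translates[OF \<alpha> that])
      also have "(\<lambda>x. map (\<lambda>i. cell {B, - B} (S i) x) [0..<k])
          = map (\<lambda>z. if z then {B} else {- B}) \<circ> ?X"
        by (auto simp: fun_eq_iff cell_def)
      also have "\<H>(\<dots>) \<le> \<H>(?X)"
        using sB by (intro entropy_data_processing simple_function_map simple_function_mem sets_vimage_T)
      also have "\<dots> \<le> h + 2 * sqrt e * length [0..<k]"
      proof -
        have "\<exists>W\<in>set Ws. prob (sym_diff (T (S i) -` B) W) \<le> e" for i
          using net[of "S i"] S ws by (auto simp: Ws_def intro: less_imp_le)
        moreover have "set Ws \<subseteq> sets M"
          using sB by (auto simp: Ws_def sets_vimage_T)
        ultimately show ?thesis
          using entropy_map_mem_le_net[of "[0..<k]" "\<lambda>i. T (S i) -` B" Ws e] sets_vimage_T[OF sB]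
          by (simp add: h_def)
      qed
      finally show ?thesis using \<open>0 < \<delta>\<close> by (simp add: e_def real_sqrt_abs)
    qed
    \<comment> \<open>From \<open>K\<close> steps on, \<open>h\<close> is absorbed by the other half
      of \<open>\<delta> * k\<close>.\<close>
    obtain K :: nat where K: "h < K * (\<delta> / 2)"
      using reals_Archimedean3[of "\<delta> / 2"] \<open>0 < \<delta>\<close> half_gt_zero by blast
    have "ereal (1 / real k * ?H k) \<le> ereal \<delta>" if k: "max 1 K \<le> k" for k
    proof -
      have "K * (\<delta> / 2) \<le> k * (\<delta> / 2)"
        using k \<open>0 < \<delta>\<close> by (intro mult_right_mono) auto
      then have "?H k \<le> \<delta> * k"
        using bound[of k] K k by (simp add: field_simps)
      then show ?thesis using k by (simp add: field_simps)
    qed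
    then show ?thesis
      unfolding sequence_entropy_def
      by (intro Limsup_bounded) (auto simp: eventually_sequentially intro!: exI[of _ "max 1 K"])
  qed
  show "sequence_entropy M T S {B, - B} \<le> 0"
    by (rule ereal_le_epsilon2) (use le in \<open>auto simp: zero_ereal_def\<close>)
qed

text \<open>Without a finite net at some scale \<open>e\<close>, vectors can be chosen one by one so
  that each adds at least \<open>e / 2\<close> of conditional entropy. By the chain rule the joint
  entropy grows linearly.\<close>

lemma ex_positive_sequence_entropy:
  assumes \<alpha>: "finite_measurable_partition M \<alpha>" and A: "A \<in> \<alpha>" "A \<notin> directional_Kronecker M T \<beta>"
    and "0 < b"
  shows "\<exists>S :: nat \<Rightarrow> int \<times> int. inj S \<and> range S \<subseteq> strip \<beta> b \<and> 0 < sequence_entropy M T S \<alpha>"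
proof -
  have sA: "A \<in> sets M" using \<alpha> A(1) by (auto simp: finite_measurable_partition_def)
  let ?V = "\<lambda>v. T v -` A"
  obtain e where "0 < e"
    and no_net: "\<And>F. F \<subseteq> strip \<beta> b \<Longrightarrow> finite F \<Longrightarrow>
      \<exists>v\<in>strip \<beta> b. \<forall>w\<in>F. e \<le> prob (sym_diff (?V v) (?V w))"
    using A(2) sA directional_Kronecker_iff[OF \<open>0 < b\<close>, of A \<beta>] by (metis not_less)
  \<comment> \<open>The net obtained from small conditional entropy has tolerance
    \<open>2 * c\<close>, which must equal \<open>e\<close>.\<close>
  define c where "c = e / 2"
  have "0 < c" using \<open>0 < e\<close> by (simp add: c_def)
  \<comment> \<open>\<open>G\<close> collects the vectors already used. Avoiding it is harmless: a
    finite net for the remaining vectors, together with \<open>G\<close>, would be a finite net for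
    the whole strip.\<close>
  have new: "\<exists>v\<in>strip \<beta> b - G. c \<le> \<H>((\<lambda>x. x \<in> ?V v) | X)"
    if X: "simple_function M X" and G: "finite G" "G \<subseteq> strip \<beta> b" for G X
  proof (rule ccontr)
    assume "\<not> ?thesis"
    then have "\<And>v. v \<in> strip \<beta> b - G \<Longrightarrow> ln (exp 1) * \<H>((\<lambda>x. x \<in> ?V v) | X) < c"
      by force
    note small_conditional_entropy_imp_finite_net[where B = ?V, OF X sets_vimage_T[OF sA] this]
    then obtain F where F: "F \<subseteq> strip \<beta> b - G" "finite F"
      and net: "\<And>v. v \<in> strip \<beta> b - G \<Longrightarrow> \<exists>w\<in>F. prob (sym_diff (?V v) (?V w)) < 2 * c"
      by metis
    obtain v where v: "v \<in> strip \<beta> b" "\<forall>w\<in>F \<union> G. e \<le> prob (sym_diff (?V v) (?V w))"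
      using no_net[of "F \<union> G"] F G by blast
    show False
    proof (cases "v \<in> G")
      case True
      then have "e \<le> prob (sym_diff (?V v) (?V v))" using v by blast
      then show False using \<open>0 < e\<close> by simp
    next
      case False
      then show False using net[of v] v by (force simp: c_def)
    qed
  qed
  let ?I = "\<lambda>S k x. map (\<lambda>i. cell \<alpha> (S i) x) [0..<k]"
  have sI: "simple_function M (?I S k)" for S :: "nat \<Rightarrow> int \<times> int" and k
    by (intro simple_function_map simple_function_cell[OF \<alpha>])
  have "\<exists>S. \<forall>k. S k \<in> strip \<beta> b - S ` {..<k} \<and> c \<le> \<H>(cell \<alpha> (S k) | ?I S k)"
  \<comment> \<open>The condition on \<open>S k\<close> involves only earlier values of
    \<open>S\<close>, so recursive choice applies.\<close>
  proof (rule dependent_wellorder_choice)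
    fix r :: "int \<times> int" and f g :: "nat \<Rightarrow> int \<times> int" and k
    assume eq: "\<And>i. i < k \<Longrightarrow> f i = g i"
    have "f ` {..<k} = g ` {..<k}" using eq by (intro image_cong) auto
    moreover have "?I f k = ?I g k" using eq by (auto simp: fun_eq_iff)
    ultimately show "(r \<in> strip \<beta> b - f ` {..<k} \<and> c \<le> \<H>(cell \<alpha> r | ?I f k))
      = (r \<in> strip \<beta> b - g ` {..<k} \<and> c \<le> \<H>(cell \<alpha> r | ?I g k))"
      by (simp only:)
  next
    fix k and S :: "nat \<Rightarrow> int \<times> int"
    assume "\<And>i. i < k \<Longrightarrow> S i \<in> strip \<beta> b - S ` {..<i} \<and> c \<le> \<H>(cell \<alpha> (S i) | ?I S i)"
    then have "S ` {..<k} \<subseteq> strip \<beta> b" by auto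
    from new[OF sI _ this] obtain v where v: "v \<in> strip \<beta> b - S ` {..<k}"
      and "c \<le> \<H>((\<lambda>x. x \<in> ?V v) | ?I S k)"
      by blast
    \<comment> \<open>Membership in the translate of \<open>A\<close> is a function of the cell, so
      the whole partition gains at least as much entropy as \<open>A\<close> does.\<close>
    moreover have "(\<lambda>x. x \<in> ?V v) = (\<lambda>u. A \<in> u) \<circ> cell \<alpha> v"
      using A(1) by (auto simp: cell_def)
    ultimately have "c \<le> \<H>(cell \<alpha> v | ?I S k)"
      using conditional_entropy_data_processing[OF sI[of S k] simple_function_cell[OF \<alpha>], of "\<lambda>u. A \<in> u" v]
      by (simp only:)
    with v show "\<exists>v. v \<in> strip \<beta> b - S ` {..<k} \<and> c \<le> \<H>(cell \<alpha> v | ?I S k)" by blast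
  qed
  then obtain S where *: "\<forall>k. S k \<in> strip \<beta> b - S ` {..<k} \<and> c \<le> \<H>(cell \<alpha> (S k) | ?I S k)"
    ..
  have S: "S k \<in> strip \<beta> b - S ` {..<k}" for k
    using conjunct1[OF spec[OF *]] .
  have gain: "c \<le> \<H>(cell \<alpha> (S k) | ?I S k)" for k
    using conjunct2[OF spec[OF *]] .
  have "inj S"
  proof (rule linorder_injI)
    fix i j :: nat assume "i < j"
    then have "S i \<in> S ` {..<j}" by blast
    then show "S i \<noteq> S j" using S[of j] by (metis DiffD2)
  qed
  have "range S \<subseteq> strip \<beta> b" using S by blast
  have grow: "c * k \<le> \<H>(?I S k)" for k
  proof (induction k)
    case 0
    then show ?case using entropy_nonneg_simple[OF sI[of S 0]] by simp
  next
    case (Suc k)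
    have "\<H>(?I S (Suc k)) = \<H>(?I S k) + \<H>(cell \<alpha> (S k) | ?I S k)"
      using entropy_map_append[of "[0..<k]" "\<lambda>i. cell \<alpha> (S i)" k] simple_function_cell[OF \<alpha>] by simp
    then show ?case using Suc gain[of k] by (simp add: algebra_simps)
  qed
  have "ereal c \<le> sequence_entropy M T S \<alpha>"
    unfolding sequence_entropy_def
  proof (rule le_Limsup)
    show "\<forall>\<^sub>F k in sequentially. ereal c \<le> ereal (1 / real k *
        partition_entropy M (common_refinement ((\<lambda>i. translate_partition T (S i) \<alpha>) ` {..<k})))"
      using eventually_gt_at_top[of 0]
    proof eventually_elim
      case (elim k)
      then show ?case
        using grow[of k] by (simp add: partition_entropy_translates[OF \<alpha>] field_simps)
    qed
  qed simp
  then have "0 < sequence_entropy M T S \<alpha>"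
    using \<open>0 < c\<close> by (metis ereal_less(2) order_less_le_trans)
  with \<open>inj S\<close> \<open>range S \<subseteq> strip \<beta> b\<close> show ?thesis by blast
qed

end

theorem theorem1p3:
  fixes M :: "'a :: metric_space measure"
    and T :: "int \<times> int \<Rightarrow> 'a \<Rightarrow> 'a"
    and \<beta> b :: real
  assumes "Z2_mpds M T"
    and "\<beta> \<notin> \<rat>"
    and "0 < b"
  shows "directional_weak_mixing M T \<beta> \<longleftrightarrow>
    (\<forall>\<alpha>. finite_measurable_partition M \<alpha> \<and> nontrivial_partition M \<alpha> \<longrightarrow>
      (\<exists>S :: nat \<Rightarrow> int \<times> int. inj S \<and> range S \<subseteq> strip \<beta> b \<and> sequence_entropy M T S \<alpha> > 0))"
proof -
  interpret Z2_mpds M T by fact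
  show ?thesis
  proof (intro iffI allI impI)
    fix \<alpha> assume wm: "directional_weak_mixing M T \<beta>"
      and \<alpha>: "finite_measurable_partition M \<alpha> \<and> nontrivial_partition M \<alpha>"
    then obtain A where A: "A \<in> \<alpha>" "0 < prob A" "prob A < 1"
      by (auto simp: nontrivial_partition_def)
    then have "A \<notin> directional_Kronecker M T \<beta>"
      using wm by (auto simp: directional_weak_mixing_def)
    with \<alpha> A(1) \<open>0 < b\<close>
    show "\<exists>S :: nat \<Rightarrow> int \<times> int. inj S \<and> range S \<subseteq> strip \<beta> b \<and> sequence_entropy M T S \<alpha> > 0"
      by (intro ex_positive_sequence_entropy) auto
  next
    assume R: "\<forall>\<alpha>. finite_measurable_partition M \<alpha> \<and> nontrivial_partition M \<alpha> \<longrightarrow>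
      (\<exists>S :: nat \<Rightarrow> int \<times> int. inj S \<and> range S \<subseteq> strip \<beta> b \<and> sequence_entropy M T S \<alpha> > 0)"
    show "directional_weak_mixing M T \<beta>"
      unfolding directional_weak_mixing_def
    proof (rule ballI, rule ccontr)
      \<comment> \<open>A Kronecker set of intermediate measure forms with its complement a
        nontrivial partition whose sequence entropy is at most 0 along every sequence in the
        strip.\<close>
      fix B assume B: "B \<in> directional_Kronecker M T \<beta>" and "\<not> (prob B = 0 \<or> prob B = 1)"
      then have p: "0 < prob B" "prob B < 1"
        using prob_le_1[of B] measure_nonneg[of M B] by linarith+
      then have ne: "B \<noteq> {}" "B \<noteq> UNIV"
        using prob_space by (auto simp: space_eq_UNIV)
      have "finite_measurable_partition M {B, - B}"
        using B ne by (intro finite_measurable_partition_Compl) (auto simp: directional_Kronecker_def)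
      moreover have "nontrivial_partition M {B, - B}"
        using p by (auto simp: nontrivial_partition_def)
      ultimately obtain S where "range S \<subseteq> strip \<beta> b" "0 < sequence_entropy M T S {B, - B}"
        using R by blast
      then show False
        using sequence_entropy_directional_Kronecker[OF B ne \<open>0 < b\<close>] by (meson not_less)
    qed
  qed
qed

end
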